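(* Let $1 \le S < N$ and $\sigma^2 > 0$, and consider the sparse signal in noise model $\mathbf{y} = \mathbf{x} + \mathbf{n}$ with unknown nonrandom parameter $\mathbf{x} \in \mathcal{X}_S$ and $\mathbf{n} \sim \mathcal{N}(\mathbf{0},\sigma^2\mathbf{I})$ in $\mathbb{R}^N$. Let $\hat{\mathbf{x}}(\cdot) : \mathbb{R}^N \to \mathbb{R}^N$ be an unbiased estimator, i.e., $\mathsf{E}_{\mathbf{x}}\{\hat{\mathbf{x}}(\mathbf{y})\} = \mathbf{x}$ for all $\mathbf{x} \in \mathcal{X}_S$. Then the mean squared error of $\hat{\mathbf{x}}(\cdot)$ at any given $\mathbf{x} = \mathbf{x}_0 \in \mathcal{X}_S$ satisfies $$ \varepsilon(\hat{\mathbf{x}}(\cdot);\mathbf{x}_0) \;\ge\; \big[ S + (N-S)\, e^{-\xi^2(\mathbf{x}_0)/\sigma^2} \big]\, \sigma^2 . $$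
   Context: $\|\mathbf{x}\|_0$ is the number of nonzero entries of $\mathbf{x}$, and $\mathcal{X}_S := \{\mathbf{x} \in \mathbb{R}^N : \|\mathbf{x}\|_0 \le S\}$. $\mathsf{E}_{\mathbf{x}}\{\cdot\}$ denotes expectation when $\mathbf{y} \sim \mathcal{N}(\mathbf{x},\sigma^2\mathbf{I})$. An estimator is a (measurable) function of $\mathbf{y}$. Its mean squared error at $\mathbf{x}_0$ is $\varepsilon(\hat{\mathbf{x}}(\cdot);\mathbf{x}_0) := \mathsf{E}_{\mathbf{x}_0}\{\|\hat{\mathbf{x}}(\mathbf{y}) - \mathbf{x}_0\|_2^2\}$. $\xi(\mathbf{x}_0)$ denotes the value of the $S$-largest (in magnitude) entry of $\mathbf{x}_0$, i.e., the $S$th entry when the entries are sorted by decreasing magnitude. Thus $\xi(\mathbf{x}_0)$ is the smallest (in magnitude) nonzero entry of $\mathbf{x}_0$ if $\|\mathbf{x}_0\|_0 = S$, and $\xi(\mathbf{x}_0) = 0$ if $\|\mathbf{x}_0\|_0 < S$. *)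

theory Defs
  imports "HOL-Probability.Probability"
begin

definition l0_norm :: "real ^ 'n \<Rightarrow> nat" where
  "l0_norm x = card {i. x $ i \<noteq> 0}"

definition sparse_vectors :: "nat \<Rightarrow> (real ^ 'n) set" where
  "sparse_vectors S = {x. l0_norm x \<le> S}"

text \<open>The law \<open>N(x, \<sigma>\<^sup>2 I)\<close>. The second argument is the standard deviation, as in
  \<^const>\<open>normal_density\<close>.\<close>

definition white_normal :: "real ^ 'n \<Rightarrow> real \<Rightarrow> (real ^ 'n) measure" where
  "white_normal x \<sigma> =
     density lborel (\<lambda>y. ennreal (\<Prod>i\<in>UNIV. normal_density (x $ i) \<sigma> (y $ i)))"

text \<open>Integrability is part of unbiasedness: the Bochner integral of a non-integrable
  function is \<open>0\<close> by convention.\<close>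

definition unbiased_on ::
    "(real ^ 'n) set \<Rightarrow> real \<Rightarrow> (real ^ 'n \<Rightarrow> real ^ 'n) \<Rightarrow> bool" where
  "unbiased_on X \<sigma> xhat \<longleftrightarrow>
     (\<forall>x\<in>X. integrable (white_normal x \<sigma>) xhat \<and> (\<integral>y. xhat y \<partial>white_normal x \<sigma>) = x)"

text \<open>The mean squared error takes values in \<^typ>\<open>ennreal\<close> because it may be infinite.\<close>

definition mse :: "real \<Rightarrow> (real ^ 'n \<Rightarrow> real ^ 'n) \<Rightarrow> real ^ 'n \<Rightarrow> ennreal" where
  "mse \<sigma> xhat x0 = (\<integral>\<^sup>+ y. ennreal ((norm (xhat y - x0))\<^sup>2) \<partial>white_normal x0 \<sigma>)"

definition decreasing_magnitude_order :: "real ^ 'n \<Rightarrow> (nat \<Rightarrow> 'n) \<Rightarrow> bool" where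
  "decreasing_magnitude_order x p \<longleftrightarrow>
     bij_betw p {1..CARD('n)} UNIV \<and>
     (\<forall>i\<in>{1..CARD('n)}. \<forall>j\<in>{1..CARD('n)}. i \<le> j \<longrightarrow> \<bar>x $ p j\<bar> \<le> \<bar>x $ p i\<bar>)"

text \<open>The \<open>S\<close>-largest entry in magnitude. If several entries tie in magnitude, the order is
  not unique; the choice can only affect the sign of the value, not its square.\<close>

definition S_largest_entry :: "nat \<Rightarrow> real ^ 'n \<Rightarrow> real" where
  "S_largest_entry S x = x $ (SOME p. decreasing_magnitude_order x p) S"

lemma ex_decreasing_magnitude_order:
  fixes x :: "real ^ 'n"
  shows "\<exists>p. decreasing_magnitude_order x p"
proof -
  obtain ys :: "'n list" where ys: "set ys = UNIV" "distinct ys"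
    using finite_distinct_list[OF finite] by blast
  define xs where "xs = sort_key (\<lambda>i. - \<bar>x $ i\<bar>) ys"
  have xs: "set xs = UNIV" "distinct xs" "sorted (map (\<lambda>i. - \<bar>x $ i\<bar>) xs)"
    using ys by (auto simp: xs_def)
  have len: "length xs = CARD('n)"
    using xs distinct_card by metis
  have "bij_betw ((!) xs) {..<length xs} UNIV"
    using xs by (intro bij_betw_nth) auto
  moreover have "bij_betw (\<lambda>k. k - 1) {1..CARD('n)} {..<length xs}"
    by (rule bij_betw_byWitness[where f' = Suc]) (auto simp: len)
  ultimately have "bij_betw (\<lambda>k. xs ! (k - 1)) {1..CARD('n)} UNIV"
    using bij_betw_trans by (fastforce simp: o_def)
  moreover have "\<bar>x $ (xs ! (j - 1))\<bar> \<le> \<bar>x $ (xs ! (i - 1))\<bar>"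
    if "i \<in> {1..CARD('n)}" "j \<in> {1..CARD('n)}" "i \<le> j" for i j
    using sorted_nth_mono[OF xs(3), of "i - 1" "j - 1"] that len by auto
  ultimately show ?thesis
    unfolding decreasing_magnitude_order_def by blast
qed

end

theory Submission imports Defs "HOL-Real_Asymp.Real_Asymp" begin

text \<open>Let \<open>\<rho>\<^sub>x\<close> be the likelihood ratio of \<open>N(x, \<sigma>\<^sup>2 I)\<close> with respect to \<open>N(x0, \<sigma>\<^sup>2 I)\<close>. In
  \<open>L\<^sup>2(N(x0, \<sigma>\<^sup>2 I))\<close> the inner product of \<open>\<rho>\<^sub>x\<close> and \<open>\<rho>\<^sub>z\<close> is \<open>exp ((x - x0) \<bullet> (z - x0) / \<sigma>\<^sup>2)\<close>.
  If \<open>w\<close> and \<open>w + t e\<^sub>k\<close> are sparse and \<open>w - x0\<close> is orthogonal to \<open>e\<^sub>k\<close>, then unbiasedness and the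
  Cauchy-Schwarz inequality applied to the \<open>k\<close>-th error component and the difference of the
  likelihood ratios of \<open>w + t e\<^sub>k\<close> and \<open>w\<close> bound the \<open>k\<close>-th error from below by
  \<open>t\<^sup>2 / (exp (\<parallel>w - x0\<parallel>\<^sup>2 / \<sigma>\<^sup>2) (exp (t\<^sup>2 / \<sigma>\<^sup>2) - 1))\<close>, which tends to
  \<open>\<sigma>\<^sup>2 exp (- \<parallel>w - x0\<parallel>\<^sup>2 / \<sigma>\<^sup>2)\<close> as \<open>t \<rightarrow> 0\<close>. For the \<open>S\<close> largest entries take \<open>w = x0\<close>; for the
  others, obtain \<open>w\<close> from \<open>x0\<close> by deleting the \<open>S\<close>-largest entry.\<close>

definition white_density :: "real ^ 'n \<Rightarrow> real \<Rightarrow> real ^ 'n \<Rightarrow> real" where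
  "white_density x \<sigma> y = (\<Prod>i\<in>UNIV. normal_density (x $ i) \<sigma> (y $ i))"

lemma white_normal_density: "white_normal x \<sigma> = density lborel (white_density x \<sigma>)"
  by (simp add: white_normal_def white_density_def)

lemma white_density_exp:
  fixes x :: "real ^ 'n"
  shows "white_density x \<sigma> y =
    (1 / sqrt (2 * pi * \<sigma>\<^sup>2)) ^ CARD('n) * exp (- (norm (y - x))\<^sup>2 / (2 * \<sigma>\<^sup>2))"
proof -
  have "(\<Sum>i\<in>UNIV. - (y $ i - x $ i)\<^sup>2 / (2 * \<sigma>\<^sup>2)) = - (norm (y - x))\<^sup>2 / (2 * \<sigma>\<^sup>2)"
    by (simp add: norm_vec_def L2_set_def sum_nonneg sum_negf sum_divide_distrib)
  then show ?thesis
    unfolding white_density_def normal_density_def prod.distrib exp_sum[OF finite, symmetric]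
    by (simp only: prod_constant)
qed

lemma white_density_nonneg: "0 \<le> white_density x \<sigma> y"
  by (simp add: white_density_exp)

lemma white_density_pos: "\<sigma> > 0 \<Longrightarrow> 0 < white_density x \<sigma> y"
  by (simp add: white_density_exp)

lemma borel_measurable_white_density [measurable]:
  "white_density x \<sigma> \<in> borel_measurable borel"
  unfolding white_density_exp[abs_def] by measurable

lemma nn_integral_white_density:
  fixes x :: "real ^ 'n"
  assumes "\<sigma> > 0"
  shows "(\<integral>\<^sup>+ y. ennreal (white_density x \<sigma> y) \<partial>lborel) = 1"
proof -
  have one: "(\<integral>\<^sup>+ t. ennreal (normal_density \<mu> \<sigma> t) \<partial>lborel) = 1" for \<mu>
    using prob_space.emeasure_space_1[OF prob_space_normal_density[OF assms, of \<mu>]]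
    by (simp add: emeasure_density)
  have prod_Basis: "(\<Prod>b\<in>Basis. g b) = (\<Prod>i\<in>UNIV. g (axis i 1))"
    for g :: "real ^ 'n \<Rightarrow> ennreal"
  proof -
    have "Basis = range (\<lambda>i. axis i 1 :: real ^ 'n)"
      by (auto simp: Basis_vec_def)
    moreover have "inj (\<lambda>i. axis i 1 :: real ^ 'n)"
      by (auto simp: inj_on_def axis_eq_axis)
    ultimately show ?thesis
      using prod.reindex[of "\<lambda>i. axis i 1 :: real ^ 'n" UNIV g] by (simp only: o_def)
  qed
  have "(\<integral>\<^sup>+ y. ennreal (white_density x \<sigma> y) \<partial>lborel) =
      (\<integral>\<^sup>+ y. (\<Prod>b\<in>Basis. ennreal (normal_density (x \<bullet> b) \<sigma> (y \<bullet> b))) \<partial>lborel)"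
    by (simp add: white_density_def prod_Basis inner_axis prod_ennreal)
  also have "\<dots> = (\<Prod>b\<in>Basis. \<integral>\<^sup>+ t. ennreal (normal_density (x \<bullet> b) \<sigma> t) \<partial>lborel)"
    by (rule nn_integral_lborel_prod) auto
  finally show ?thesis
    by (simp add: one)
qed

lemma has_bochner_integral_white_density:
  "\<sigma> > 0 \<Longrightarrow> has_bochner_integral lborel (white_density x \<sigma>) 1"
  by (rule has_bochner_integral_nn_integral)
     (auto simp: nn_integral_white_density white_density_nonneg)

lemma white_density_mult:
  assumes "\<sigma> > 0"
  shows "white_density x1 \<sigma> y * white_density x2 \<sigma> y / white_density x0 \<sigma> y =
    exp ((x1 - x0) \<bullet> (x2 - x0) / \<sigma>\<^sup>2) * white_density (x1 + x2 - x0) \<sigma> y"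
proof -
  have "(norm (y - x1))\<^sup>2 + (norm (y - x2))\<^sup>2 =
      (norm (y - x0))\<^sup>2 + (norm (y - (x1 + x2 - x0)))\<^sup>2 - 2 * ((x1 - x0) \<bullet> (x2 - x0))"
    unfolding power2_norm_eq_inner by (simp add: inner_simps inner_commute algebra_simps)
  then have "- (norm (y - x1))\<^sup>2 / (2 * \<sigma>\<^sup>2) + - (norm (y - x2))\<^sup>2 / (2 * \<sigma>\<^sup>2) =
      - (norm (y - x0))\<^sup>2 / (2 * \<sigma>\<^sup>2) + ((x1 - x0) \<bullet> (x2 - x0) / \<sigma>\<^sup>2 +
        - (norm (y - (x1 + x2 - x0)))\<^sup>2 / (2 * \<sigma>\<^sup>2))"
    using assms by (simp add: divide_simps)
  then have "exp (- (norm (y - x1))\<^sup>2 / (2 * \<sigma>\<^sup>2)) * exp (- (norm (y - x2))\<^sup>2 / (2 * \<sigma>\<^sup>2)) =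
      exp (- (norm (y - x0))\<^sup>2 / (2 * \<sigma>\<^sup>2)) * (exp ((x1 - x0) \<bullet> (x2 - x0) / \<sigma>\<^sup>2) *
        exp (- (norm (y - (x1 + x2 - x0)))\<^sup>2 / (2 * \<sigma>\<^sup>2)))"
    by (simp only: exp_add[symmetric])
  then show ?thesis
    using assms by (simp add: white_density_exp field_simps)
qed

lemma integrable_white_normal_iff:
  fixes f :: "real ^ 'n \<Rightarrow> real"
  assumes [measurable]: "f \<in> borel_measurable borel"
  shows "integrable (white_normal x \<sigma>) f \<longleftrightarrow> integrable lborel (\<lambda>y. white_density x \<sigma> y * f y)"
    and "(\<integral>y. f y \<partial>white_normal x \<sigma>) = (\<integral>y. white_density x \<sigma> y * f y \<partial>lborel)"
  unfolding white_normal_density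
  by (subst integrable_density integral_density; simp add: white_density_nonneg)+

lemma chapman_robbins_white_normal:
  fixes f :: "real ^ 'n \<Rightarrow> real"
  assumes \<sigma>: "\<sigma> > 0" and f [measurable]: "f \<in> borel_measurable borel"
    and int1: "integrable (white_normal x1 \<sigma>) f"
    and int2: "integrable (white_normal x2 \<sigma>) f"
  shows "ennreal (((\<integral>y. f y \<partial>white_normal x1 \<sigma>) - (\<integral>y. f y \<partial>white_normal x2 \<sigma>))\<^sup>2 /
      (exp ((norm (x1 - x0))\<^sup>2 / \<sigma>\<^sup>2) - 2 * exp ((x1 - x0) \<bullet> (x2 - x0) / \<sigma>\<^sup>2)
        + exp ((norm (x2 - x0))\<^sup>2 / \<sigma>\<^sup>2)))
    \<le> (\<integral>\<^sup>+ y. ennreal ((f y - c)\<^sup>2) \<partial>white_normal x0 \<sigma>)"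
    (is "ennreal (?m\<^sup>2 / ?D) \<le> ?V")
proof (cases "?D > 0 \<and> ?V < \<infinity>")
  case False
  \<comment> \<open>\<open>?D = 0\<close> is covered by the convention \<open>x / 0 = 0\<close>.\<close>
  moreover have "ennreal (?m\<^sup>2 / ?D) = 0" if "\<not> ?D > 0"
    using that by (intro ennreal_neg divide_nonneg_nonpos) auto
  ultimately show ?thesis
    by (auto simp: less_top[symmetric] top_unique)
next
  case True
  define D where "D = ?D"
  define m where "m = ?m"
  let ?\<phi> = "\<lambda>x. white_density x \<sigma>"
  let ?a = "\<lambda>y. f y - c"
  let ?g = "\<lambda>y. ?\<phi> x1 y - ?\<phi> x2 y"
  define V where "V = (\<integral>y. ?\<phi> x0 y * (?a y)\<^sup>2 \<partial>lborel)"
  have V_eq: "?V = (\<integral>\<^sup>+ y. ennreal (?\<phi> x0 y * (?a y)\<^sup>2) \<partial>lborel)"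
    unfolding white_normal_density
    by (subst nn_integral_density) (auto simp: ennreal_mult' white_density_nonneg)
  have "integrable lborel (\<lambda>y. ?\<phi> x0 y * (?a y)\<^sup>2)"
    using True by (intro integrableI_nonneg) (auto simp: V_eq white_density_nonneg)
  then have V: "has_bochner_integral lborel (\<lambda>y. ?\<phi> x0 y * (?a y)\<^sup>2) V" and "?V = ennreal V"
    unfolding V_def V_eq
    by (auto simp: has_bochner_integral_iff white_density_nonneg intro!: nn_integral_eq_integral)
  have fx: "has_bochner_integral lborel (\<lambda>y. ?\<phi> x y * f y) (\<integral>y. f y \<partial>white_normal x \<sigma>)"
    if "integrable (white_normal x \<sigma>) f" for x
    using that by (simp add: has_bochner_integral_iff integrable_white_normal_iff)
  note \<phi> = has_bochner_integral_white_density[OF \<sigma>]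
  have "has_bochner_integral lborel
      (\<lambda>y. (?\<phi> x1 y * f y - ?\<phi> x2 y * f y) - c * (?\<phi> x1 y - ?\<phi> x2 y)) (m - c * (1 - 1))"
    unfolding m_def
    by (intro has_bochner_integral_diff has_bochner_integral_mult_right fx int1 int2 \<phi>)
  then have A: "has_bochner_integral lborel (\<lambda>y. ?a y * ?g y) m"
    by (simp add: algebra_simps)
  have "has_bochner_integral lborel
      (\<lambda>y. exp ((x1 - x0) \<bullet> (x1 - x0) / \<sigma>\<^sup>2) * ?\<phi> (x1 + x1 - x0) y
        - 2 * (exp ((x1 - x0) \<bullet> (x2 - x0) / \<sigma>\<^sup>2) * ?\<phi> (x1 + x2 - x0) y)
        + exp ((x2 - x0) \<bullet> (x2 - x0) / \<sigma>\<^sup>2) * ?\<phi> (x2 + x2 - x0) y)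
      (exp ((x1 - x0) \<bullet> (x1 - x0) / \<sigma>\<^sup>2) * 1 - 2 * (exp ((x1 - x0) \<bullet> (x2 - x0) / \<sigma>\<^sup>2) * 1)
        + exp ((x2 - x0) \<bullet> (x2 - x0) / \<sigma>\<^sup>2) * 1)"
    by (intro has_bochner_integral_diff has_bochner_integral_add
        has_bochner_integral_mult_right \<phi>)
  moreover have "(?g y)\<^sup>2 / ?\<phi> x0 y = ?\<phi> x1 y * ?\<phi> x1 y / ?\<phi> x0 y
      - 2 * (?\<phi> x1 y * ?\<phi> x2 y / ?\<phi> x0 y) + ?\<phi> x2 y * ?\<phi> x2 y / ?\<phi> x0 y" for y
    using white_density_pos[OF \<sigma>, of x0 y] by (simp add: power2_eq_square field_simps)
  ultimately have B: "has_bochner_integral lborel (\<lambda>y. (?g y)\<^sup>2 / ?\<phi> x0 y) D"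
    by (simp add: D_def power2_norm_eq_inner white_density_mult[OF \<sigma>])
  have "has_bochner_integral lborel
      (\<lambda>y. D\<^sup>2 * (?\<phi> x0 y * (?a y)\<^sup>2) - 2 * D * m * (?a y * ?g y) + m\<^sup>2 * ((?g y)\<^sup>2 / ?\<phi> x0 y))
      (D\<^sup>2 * V - 2 * D * m * m + m\<^sup>2 * D)"
    by (intro has_bochner_integral_diff has_bochner_integral_add
        has_bochner_integral_mult_right V A B)
  moreover have "D\<^sup>2 * (?\<phi> x0 y * (?a y)\<^sup>2) - 2 * D * m * (?a y * ?g y) + m\<^sup>2 * ((?g y)\<^sup>2 / ?\<phi> x0 y)
      = (D * ?a y * ?\<phi> x0 y - m * ?g y)\<^sup>2 / ?\<phi> x0 y" for y
    using white_density_pos[OF \<sigma>, of x0 y] by (simp add: power2_eq_square field_simps)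
  ultimately have "0 \<le> D\<^sup>2 * V - 2 * D * m * m + m\<^sup>2 * D"
    by (auto dest!: has_bochner_integral_integral_eq[symmetric]
        simp: white_density_nonneg intro!: integral_nonneg_AE)
  then have "0 \<le> D * (D * V - m\<^sup>2)"
    by (simp add: power2_eq_square algebra_simps)
  moreover have "0 < D"
    using True by (simp only: D_def)
  ultimately have "m\<^sup>2 / D \<le> V"
    by (simp add: zero_le_mult_iff pos_divide_le_eq mult.commute)
  then show ?thesis
    using \<open>?V = ennreal V\<close> by (simp add: D_def m_def ennreal_leI)
qed

lemma cramer_rao_white_normal:
  fixes f :: "real ^ 'n \<Rightarrow> real"
  assumes \<sigma>: "\<sigma> > 0" and f: "f \<in> borel_measurable borel"
    and e: "norm e = 1" "(w - x0) \<bullet> e = 0"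
    and unbiased: "\<And>t. integrable (white_normal (w + t *\<^sub>R e) \<sigma>) f"
      "\<And>t. (\<integral>y. f y \<partial>white_normal (w + t *\<^sub>R e) \<sigma>) = b + t"
  shows "ennreal (exp (- (norm (w - x0))\<^sup>2 / \<sigma>\<^sup>2) * \<sigma>\<^sup>2)
    \<le> (\<integral>\<^sup>+ y. ennreal ((f y - c)\<^sup>2) \<partial>white_normal x0 \<sigma>)"
proof (rule tendsto_upperbound)
  let ?q = "(norm (w - x0))\<^sup>2 / \<sigma>\<^sup>2"
  let ?h = "\<lambda>t. exp (- ?q) * (t\<^sup>2 / (exp (t\<^sup>2 / \<sigma>\<^sup>2) - 1))"
  have "((\<lambda>t. t\<^sup>2 / (exp (t\<^sup>2 / \<sigma>\<^sup>2) - 1)) \<longlongrightarrow> \<sigma>\<^sup>2) (at_right 0)"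
    using \<sigma> by real_asymp
  then show "((\<lambda>t. ennreal (?h t)) \<longlongrightarrow> ennreal (exp (- (norm (w - x0))\<^sup>2 / \<sigma>\<^sup>2) * \<sigma>\<^sup>2)) (at_right 0)"
    by (auto intro!: tendsto_ennrealI tendsto_mult_left simp del: times_divide_eq_right)
  have "ennreal (?h t) \<le> (\<integral>\<^sup>+ y. ennreal ((f y - c)\<^sup>2) \<partial>white_normal x0 \<sigma>)" for t
  proof -
    have "(norm (w + t *\<^sub>R e - x0))\<^sup>2 = (norm (w - x0))\<^sup>2 + t\<^sup>2"
      and "(w + t *\<^sub>R e - x0) \<bullet> (w - x0) = (norm (w - x0))\<^sup>2"
      using e unfolding norm_eq_1 power2_norm_eq_inner
      by (simp_all add: inner_simps inner_commute power2_eq_square[of t] algebra_simps)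
    moreover from unbiased[of 0] have "integrable (white_normal w \<sigma>) f"
      "(\<integral>y. f y \<partial>white_normal w \<sigma>) = b"
      by simp_all
    ultimately have "ennreal (t\<^sup>2 / (exp (((norm (w - x0))\<^sup>2 + t\<^sup>2) / \<sigma>\<^sup>2) - 2 * exp ?q + exp ?q))
      \<le> (\<integral>\<^sup>+ y. ennreal ((f y - c)\<^sup>2) \<partial>white_normal x0 \<sigma>)"
      using chapman_robbins_white_normal[OF \<sigma> f unbiased(1)[of t], of w x0 c] unbiased(2)[of t]
      by simp
    also have "exp (((norm (w - x0))\<^sup>2 + t\<^sup>2) / \<sigma>\<^sup>2) - 2 * exp ?q + exp ?q
        = exp ?q * (exp (t\<^sup>2 / \<sigma>\<^sup>2) - 1)"
      by (simp add: add_divide_distrib exp_add algebra_simps)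
    finally show ?thesis
      by (simp add: exp_minus field_simps)
  qed
  then show "\<forall>\<^sub>F t in at_right 0.
      ennreal (?h t) \<le> (\<integral>\<^sup>+ y. ennreal ((f y - c)\<^sup>2) \<partial>white_normal x0 \<sigma>)"
    by simp
qed simp

lemma mse_eq_sum:
  fixes xhat :: "real ^ 'n \<Rightarrow> real ^ 'n"
  assumes [measurable]: "xhat \<in> borel_measurable borel"
  shows "mse \<sigma> xhat x0 =
    (\<Sum>k\<in>UNIV. \<integral>\<^sup>+ y. ennreal ((xhat y $ k - x0 $ k)\<^sup>2) \<partial>white_normal x0 \<sigma>)"
proof -
  have [measurable]: "(\<lambda>y. xhat y $ k) \<in> borel_measurable borel" for k
    by (rule measurable_compose[OF assms]) simp
  have "ennreal ((norm (xhat y - x0))\<^sup>2) = (\<Sum>k\<in>UNIV. ennreal ((xhat y $ k - x0 $ k)\<^sup>2))" for y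
    by (simp add: norm_vec_def L2_set_def sum_nonneg)
  then show ?thesis
    unfolding mse_def
    by (simp only:, subst nn_integral_sum) (auto simp: white_normal_density)
qed

lemma sparse_vectorsI:
  fixes x :: "real ^ 'n"
  assumes "{i. x $ i \<noteq> 0} \<subseteq> A" "card A \<le> S"
  shows "x \<in> sparse_vectors S"
  using card_mono[OF finite assms(1)] assms(2) by (simp add: sparse_vectors_def l0_norm_def)

lemma support_subset_largest_entries:
  fixes x :: "real ^ 'n"
  assumes p: "decreasing_magnitude_order x p" and x: "x \<in> sparse_vectors S"
  shows "{i. x $ i \<noteq> 0} \<subseteq> p ` {1..S}"
proof
  fix i assume i: "i \<in> {i. x $ i \<noteq> 0}"
  from p have bij: "bij_betw p {1..CARD('n)} UNIV"
    by (simp add: decreasing_magnitude_order_def)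
  then obtain n where n: "n \<in> {1..CARD('n)}" "i = p n"
    by (metis UNIV_I bij_betw_imp_surj_on imageE)
  have "x $ p m \<noteq> 0" if "m \<in> {1..n}" for m
  proof -
    have "\<bar>x $ p n\<bar> \<le> \<bar>x $ p m\<bar>"
      using p that n unfolding decreasing_magnitude_order_def by auto
    then show ?thesis
      using i n by auto
  qed
  then have "card (p ` {1..n}) \<le> card {i. x $ i \<noteq> 0}"
    by (intro card_mono) auto
  moreover have "inj_on p {1..n}"
    using n by (intro inj_on_subset[OF bij_betw_imp_inj_on[OF bij]]) auto
  ultimately have "n \<le> S"
    using x by (simp add: card_image sparse_vectors_def l0_norm_def)
  then show "i \<in> p ` {1..S}"
    using n by auto
qed

theorem mainTheorem2:
  fixes S :: nat and \<sigma> :: real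
    and xhat :: "real ^ 'n \<Rightarrow> real ^ 'n" and x0 :: "real ^ 'n"
  assumes "1 \<le> S" and "S < CARD('n)"
    and "\<sigma> > 0"
    and "xhat \<in> borel_measurable borel"
    and "unbiased_on (sparse_vectors S) \<sigma> xhat"
    and "x0 \<in> sparse_vectors S"
  shows "mse \<sigma> xhat x0 \<ge>
    ennreal ((real S + (real CARD('n) - real S) * exp (- (S_largest_entry S x0)\<^sup>2 / \<sigma>\<^sup>2)) * \<sigma>\<^sup>2)"
proof -
  define p where "p = (SOME p. decreasing_magnitude_order x0 p)"
  define j where "j = p S"
  define \<xi> where "\<xi> = S_largest_entry S x0"
  define E where "E = exp (- \<xi>\<^sup>2 / \<sigma>\<^sup>2)"
  let ?A = "p ` {1..S}"
  let ?V = "\<lambda>k. \<integral>\<^sup>+ y. ennreal ((xhat y $ k - x0 $ k)\<^sup>2) \<partial>white_normal x0 \<sigma>"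
  have p: "decreasing_magnitude_order x0 p"
    unfolding p_def by (rule someI_ex[OF ex_decreasing_magnitude_order])
  have \<xi>: "\<xi> = x0 $ j"
    by (simp add: \<xi>_def j_def p_def S_largest_entry_def)
  have inj: "inj_on p {1..S}"
    using p assms(2) unfolding decreasing_magnitude_order_def bij_betw_def
    by (auto intro: inj_on_subset)
  then have card_A: "card ?A = S"
    by (simp add: card_image)
  have j: "j \<in> ?A"
    using assms(1) by (simp add: j_def)
  have supp: "{i. x0 $ i \<noteq> 0} \<subseteq> ?A"
    using p assms(6) by (rule support_subset_largest_entries)
  have bound: "ennreal (exp (- (norm (w - x0))\<^sup>2 / \<sigma>\<^sup>2) * \<sigma>\<^sup>2) \<le> ?V k"
    if w: "\<And>t. w + t *\<^sub>R axis k 1 \<in> sparse_vectors S" "w $ k = x0 $ k" for w k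
  proof (rule cramer_rao_white_normal[where e = "axis k 1" and b = "w $ k"])
    show "(\<lambda>y. xhat y $ k) \<in> borel_measurable borel"
      by (rule measurable_compose[OF assms(4)]) simp
    fix t
    have "integrable (white_normal (w + t *\<^sub>R axis k 1) \<sigma>) xhat"
      and mean: "(\<integral>y. xhat y \<partial>white_normal (w + t *\<^sub>R axis k 1) \<sigma>) = w + t *\<^sub>R axis k 1"
      using assms(5) w(1) by (auto simp: unbiased_on_def)
    then show "integrable (white_normal (w + t *\<^sub>R axis k 1) \<sigma>) (\<lambda>y. xhat y $ k)"
      and "(\<integral>y. xhat y $ k \<partial>white_normal (w + t *\<^sub>R axis k 1) \<sigma>) = w $ k + t"
      using integrable_bounded_linear[OF bounded_linear_vec_nth]
        integral_bounded_linear[OF bounded_linear_vec_nth, of _ xhat k]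
      by (auto simp: mean)
  qed (use assms(3) w(2) in \<open>auto simp: inner_axis\<close>)
  have largest: "ennreal (\<sigma>\<^sup>2) \<le> ?V k" if "k \<in> ?A" for k
  proof -
    have "x0 + t *\<^sub>R axis k 1 \<in> sparse_vectors S" for t
      using supp that card_A
      by (intro sparse_vectorsI[of _ ?A]) (auto simp: axis_def simp del: One_nat_def split: if_splits)
    then show ?thesis
      using bound[of x0 k] by simp
  qed
  have remaining: "ennreal (E * \<sigma>\<^sup>2) \<le> ?V k" if k: "k \<notin> ?A" for k
  proof -
    let ?w = "x0 - \<xi> *\<^sub>R axis j 1"
    have "?w + t *\<^sub>R axis k 1 \<in> sparse_vectors S" for t
    proof (rule sparse_vectorsI)
      show "{i. (?w + t *\<^sub>R axis k 1) $ i \<noteq> 0} \<subseteq> insert k (?A - {j})"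
        using supp by (auto simp: axis_def \<xi> split: if_splits)
      show "card (insert k (?A - {j})) \<le> S"
        using k j assms(1) card_A by (simp del: One_nat_def)
    qed
    moreover have "?w $ k = x0 $ k"
      using k j by (auto simp: axis_def)
    ultimately show ?thesis
      using bound[of ?w k] by (simp add: E_def)
  qed
  have "ennreal ((real S + (real CARD('n) - real S) * E) * \<sigma>\<^sup>2) =
      ennreal (\<Sum>k\<in>UNIV. if k \<in> ?A then \<sigma>\<^sup>2 else E * \<sigma>\<^sup>2)"
  proof -
    have "card (- ?A) = CARD('n) - S"
      using card_Diff_subset[of ?A UNIV] card_A by (simp add: Compl_eq_Diff_UNIV del: One_nat_def)
    then show ?thesis
      using assms(2) card_A
      by (simp add: sum.If_cases of_nat_diff algebra_simps Collect_neg_eq del: One_nat_def)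
  qed
  also have "\<dots> = (\<Sum>k\<in>UNIV. ennreal (if k \<in> ?A then \<sigma>\<^sup>2 else E * \<sigma>\<^sup>2))"
    by (subst sum_ennreal) (auto simp: E_def)
  also have "\<dots> \<le> (\<Sum>k\<in>UNIV. ?V k)"
    using largest remaining by (intro sum_mono) auto
  also have "\<dots> = mse \<sigma> xhat x0"
    by (rule mse_eq_sum[symmetric, OF assms(4)])
  finally show ?thesis
    by (simp add: E_def \<xi>_def)
qed

end
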